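(* Let $P_{n_1},\dots,P_{n_r}$ be oriented paths, where $P_{n_i}$ has vertices $a_{i,1}\to a_{i,2}\to\cdots\to a_{i,n_i}$. Let $G=\square_{i=1}^r P_{n_i}$ carry a simple pebbling. Then $G\cong [S_G]$ as directed graphs.
   Context: The Cartesian product $G=\square_{i=1}^r P_{n_i}$ has vertex set all tuples $(x_1,\dots,x_r)$ with $x_i\in\{a_{i,1},\dots,a_{i,n_i}\}$, and a directed edge from $(x_1,\dots,x_r)$ to $(y_1,\dots,y_r)$ iff the tuples agree in all coordinates except one coordinate $i$, where $x_i=a_{i,j}$ and $y_i=a_{i,j+1}$ for some $j$. A simple pebbling on $G$ is a pebbling assignment such that: for each $i$, the vertex whose $i$-th coordinate is $a_{i,1}$ and whose $l$-th coordinate is $a_{l,n_l}$ for all $l\neq i$ has two or three pebbles; for each $i$ and each $1<j<n_i$, the vertex whose $i$-th coordinate is $a_{i,j}$ and whose other coordinates are $a_{l,n_l}$ ($l\neq i$) has exactly one pebble; the vertex $(a_{1,n_1},\dots,a_{r,n_r})$ has any number of pebbles; and every remaining vertex has zero or one pebble. A pebbling move along an edge $(v,w)$ (allowed when $v$ has at least two pebbles) removes two pebbles from $v$ and adds one pebble to $w$. The assignment graph $[S_G]$ is the directed graph whose vertices are all assignments obtainable from $(S_G)$ by finite sequences of pebbling moves (including $(S_G)$ itself), with a directed edge from $A$ to $B$ whenever $B$ is obtained from $A$ by a single pebbling move. *)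

theory Defs
  imports
    "HOL-Library.FuncSet"
    "Graph_Theory.Pair_Digraph"
    "Graph_Theory.Digraph_Isomorphism"
begin

definition oriented_path :: "(nat \<Rightarrow> 'a) \<Rightarrow> nat \<Rightarrow> 'a pair_pre_digraph" where
  "oriented_path a n =
    \<lparr> pverts = a ` {1..n},
      parcs = {(a j, a (Suc j)) | j. 1 \<le> j \<and> j < n} \<rparr>"

text \<open>Tuples are extensional functions on the index set, so that each tuple has exactly one
  representation.\<close>

definition cartesian_product ::
    "'i set \<Rightarrow> ('i \<Rightarrow> 'a pair_pre_digraph) \<Rightarrow> ('i \<Rightarrow> 'a) pair_pre_digraph" where
  "cartesian_product I D =
    \<lparr> pverts = (\<Pi>\<^sub>E i\<in>I. pverts (D i)),
      parcs = {(x, y). x \<in> (\<Pi>\<^sub>E i\<in>I. pverts (D i)) \<and> y \<in> (\<Pi>\<^sub>E i\<in>I. pverts (D i)) \<and>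
        (\<exists>i\<in>I. (x i, y i) \<in> parcs (D i) \<and> (\<forall>l\<in>I - {i}. x l = y l))} \<rparr>"

definition path_product ::
    "nat \<Rightarrow> (nat \<Rightarrow> nat) \<Rightarrow> (nat \<Rightarrow> nat \<Rightarrow> 'a) \<Rightarrow> (nat \<Rightarrow> 'a) pair_pre_digraph" where
  "path_product r n a = cartesian_product {1..r} (\<lambda>i. oriented_path (a i) (n i))"

text \<open>An assignment is a function on the vertex set; it is extended by 0 so that equality of
  assignments is equality of functions.\<close>

definition pebbling_assignment :: "'v pair_pre_digraph \<Rightarrow> ('v \<Rightarrow> nat) \<Rightarrow> bool" where
  "pebbling_assignment G A \<longleftrightarrow> (\<forall>v. v \<notin> pverts G \<longrightarrow> A v = 0)"

definition pebbling_move :: "'v pair_pre_digraph \<Rightarrow> ('v \<Rightarrow> nat) \<Rightarrow> ('v \<Rightarrow> nat) \<Rightarrow> bool" where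
  "pebbling_move G A B \<longleftrightarrow>
    (\<exists>(v, w) \<in> parcs G. 2 \<le> A v \<and>
      (let A' = A(v := A v - 2) in B = A'(w := A' w + 1)))"

definition assignment_graph ::
    "'v pair_pre_digraph \<Rightarrow> ('v \<Rightarrow> nat) \<Rightarrow> ('v \<Rightarrow> nat) pair_pre_digraph" where
  "assignment_graph G S =
    \<lparr> pverts = {A. (pebbling_move G)\<^sup>*\<^sup>* S A},
      parcs = {(A, B). (pebbling_move G)\<^sup>*\<^sup>* S A \<and> (pebbling_move G)\<^sup>*\<^sup>* S B \<and>
        pebbling_move G A B} \<rparr>"

definition top_vertex :: "nat \<Rightarrow> (nat \<Rightarrow> nat) \<Rightarrow> (nat \<Rightarrow> nat \<Rightarrow> 'a) \<Rightarrow> (nat \<Rightarrow> 'a)" where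
  "top_vertex r n a = (\<lambda>l\<in>{1..r}. a l (n l))"

definition axis_vertex ::
    "nat \<Rightarrow> (nat \<Rightarrow> nat) \<Rightarrow> (nat \<Rightarrow> nat \<Rightarrow> 'a) \<Rightarrow> nat \<Rightarrow> nat \<Rightarrow> (nat \<Rightarrow> 'a)" where
  "axis_vertex r n a i j = (top_vertex r n a)(i := a i j)"

text \<open>The number of pebbles on the top vertex is unconstrained by its own clause. If some
  \<open>n i = 1\<close>, then the top vertex is also the first vertex of the \<open>i\<close>-th axis, and the clause
  for that vertex applies to it.\<close>

definition simple_pebbling ::
    "nat \<Rightarrow> (nat \<Rightarrow> nat) \<Rightarrow> (nat \<Rightarrow> nat \<Rightarrow> 'a) \<Rightarrow> ((nat \<Rightarrow> 'a) \<Rightarrow> nat) \<Rightarrow> bool" where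
  "simple_pebbling r n a S \<longleftrightarrow>
    pebbling_assignment (path_product r n a) S \<and>
    (\<forall>i\<in>{1..r}. S (axis_vertex r n a i 1) \<in> {2, 3}) \<and>
    (\<forall>i\<in>{1..r}. \<forall>j. 1 < j \<and> j < n i \<longrightarrow> S (axis_vertex r n a i j) = 1) \<and>
    (\<forall>v\<in>pverts (path_product r n a).
      v \<noteq> top_vertex r n a \<and>
      (\<forall>i\<in>{1..r}. \<forall>j. 1 \<le> j \<and> j < n i \<longrightarrow> v \<noteq> axis_vertex r n a i j)
      \<longrightarrow> S v \<in> {0, 1})"

end

theory Submission
  imports Defs
begin

text \<open>
  The axes, the copies of the paths that end in the top vertex, behave as independent chains of
  dominoes. On each of them there is at most one vertex below the top with two or more pebbles,
  initially the first one. The only arc leaving that vertex runs along the axis, and a move along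
  it either makes the next vertex the unique movable one or reaches the top, from which no arc
  leaves. No other vertex ever becomes movable. So a reachable assignment is determined by the
  position \<open>k i\<close> of the movable vertex on each axis \<open>i\<close> (with \<open>k i = n i\<close> if there is none),
  every such \<open>k\<close> occurs, and a move increments one coordinate of \<open>k\<close>, which is also how the arcs
  of the product act on coordinates. Both digraphs are therefore relabellings of the same grid.
\<close>

subsection \<open>Relabelling the vertices of a digraph\<close>

definition map_digraph :: "('v \<Rightarrow> 'w) \<Rightarrow> 'v pair_pre_digraph \<Rightarrow> 'w pair_pre_digraph" where
  "map_digraph f G = \<lparr> pverts = f ` pverts G, parcs = map_prod f f ` parcs G \<rparr>"

lemma pverts_map_digraph [simp]: "pverts (map_digraph f G) = f ` pverts G"
  and parcs_map_digraph [simp]: "parcs (map_digraph f G) = map_prod f f ` parcs G"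
  by (simp_all add: map_digraph_def)

lemma pair_wf_digraph_map_digraph:
  assumes "pair_wf_digraph G"
  shows "pair_wf_digraph (map_digraph f G)"
  using pair_wf_digraph.in_arcsD1[OF assms] pair_wf_digraph.in_arcsD2[OF assms]
  by unfold_locales auto

lemma digraph_iso_map_digraph:
  assumes "pair_wf_digraph G" and inj: "inj_on f (pverts G)"
  shows "digraph_iso (with_proj G) (with_proj (map_digraph f G))"
proof -
  interpret pair_wf_digraph G by fact
  let ?h = "\<lparr>iso_verts = f, iso_arcs = map_prod f f, iso_head = snd, iso_tail = fst\<rparr>"
  have "parcs G \<subseteq> pverts G \<times> pverts G"
    by (auto dest: in_arcsD1 in_arcsD2)
  then have "inj_on (map_prod f f) (parcs G)"
    using map_prod_inj_on[OF inj inj] by (rule inj_on_subset[rotated])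
  then have "pre_digraph.digraph_isomorphism (with_proj G) ?h"
    using inj wf_digraph_axioms by (auto simp: pre_digraph.digraph_isomorphism_def)
  moreover have "with_proj (map_digraph f G) = app_iso ?h (with_proj G)"
    by (simp add: app_iso_def with_proj_def)
  ultimately show ?thesis
    unfolding digraph_iso_def by blast
qed

subsection \<open>Cartesian products of digraphs\<close>

definition map_tuple :: "'i set \<Rightarrow> ('i \<Rightarrow> 'a \<Rightarrow> 'b) \<Rightarrow> ('i \<Rightarrow> 'a) \<Rightarrow> 'i \<Rightarrow> 'b" where
  "map_tuple I f x = (\<lambda>i\<in>I. f i (x i))"

lemma map_tuple_apply [simp]: "i \<in> I \<Longrightarrow> map_tuple I f x i = f i (x i)"
  by (simp add: map_tuple_def)

lemma map_tuple_upd: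
  "i \<in> I \<Longrightarrow> map_tuple I f (x(i := u)) = (map_tuple I f x)(i := f i u)"
  by (auto simp: map_tuple_def)

lemma inj_on_map_tuple:
  assumes "\<And>i. i \<in> I \<Longrightarrow> inj_on (f i) (A i)"
  shows "inj_on (map_tuple I f) (Pi\<^sub>E I A)"
proof (rule inj_onI)
  fix x y assume x: "x \<in> Pi\<^sub>E I A" and y: "y \<in> Pi\<^sub>E I A"
    and eq: "map_tuple I f x = map_tuple I f y"
  from x y show "x = y"
  proof (rule PiE_ext)
    fix i assume i: "i \<in> I"
    then have "f i (x i) = f i (y i)"
      using fun_cong[OF eq, of i] by simp
    with assms[OF i] show "x i = y i"
      using PiE_mem[OF x i] PiE_mem[OF y i] by (rule inj_onD)
  qed
qed

lemma image_map_tuple_PiE: "map_tuple I f ` Pi\<^sub>E I A = (\<Pi>\<^sub>E i\<in>I. f i ` A i)"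
proof (intro equalityI subsetI)
  fix y assume y: "y \<in> (\<Pi>\<^sub>E i\<in>I. f i ` A i)"
  then obtain x where x: "\<And>i. i \<in> I \<Longrightarrow> x i \<in> A i \<and> y i = f i (x i)"
    unfolding PiE_iff image_iff by metis
  have "y = map_tuple I f (restrict x I)"
    using x y by (auto simp: map_tuple_def PiE_iff extensional_def)
  moreover have "restrict x I \<in> Pi\<^sub>E I A"
    using x by auto
  ultimately show "y \<in> map_tuple I f ` Pi\<^sub>E I A"
    by blast
qed (auto simp: map_tuple_def)

lemma PiE_upd_in:
  "\<lbrakk>x \<in> Pi\<^sub>E I A; i \<in> I; u \<in> A i\<rbrakk> \<Longrightarrow> x(i := u) \<in> Pi\<^sub>E I A"
  using PiE_fun_upd[of u A i x I] by (simp add: insert_absorb)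

lemma pverts_cartesian_product [simp]:
  "pverts (cartesian_product I D) = (\<Pi>\<^sub>E i\<in>I. pverts (D i))"
  by (simp add: cartesian_product_def)

lemma pair_wf_digraph_cartesian_product: "pair_wf_digraph (cartesian_product I D)"
  by unfold_locales (auto simp: cartesian_product_def)

lemma parcs_cartesian_product_updI:
  assumes "x \<in> (\<Pi>\<^sub>E i\<in>I. pverts (D i))" "i \<in> I" "pair_wf_digraph (D i)"
    and u: "(x i, u) \<in> parcs (D i)"
  shows "(x, x(i := u)) \<in> parcs (cartesian_product I D)"
proof -
  have "x(i := u) \<in> (\<Pi>\<^sub>E i\<in>I. pverts (D i))"
    using assms(1,2) pair_wf_digraph.in_arcsD2[OF assms(3) u] by (rule PiE_upd_in)
  with assms show ?thesis
    by (auto simp: cartesian_product_def)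
qed

lemma in_parcs_cartesian_product_iff:
  assumes "\<And>i. i \<in> I \<Longrightarrow> pair_wf_digraph (D i)"
  shows "(x, y) \<in> parcs (cartesian_product I D) \<longleftrightarrow>
    x \<in> (\<Pi>\<^sub>E i\<in>I. pverts (D i)) \<and> (\<exists>i\<in>I. \<exists>u. (x i, u) \<in> parcs (D i) \<and> y = x(i := u))"
    (is "?arc \<longleftrightarrow> ?upd")
proof
  assume ?arc
  then obtain i where x: "x \<in> (\<Pi>\<^sub>E i\<in>I. pverts (D i))" and y: "y \<in> (\<Pi>\<^sub>E i\<in>I. pverts (D i))"
    and i: "i \<in> I" "(x i, y i) \<in> parcs (D i)" and eq: "\<And>l. l \<in> I - {i} \<Longrightarrow> x l = y l"
    by (auto simp: cartesian_product_def)
  have "y = x(i := y i)"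
    using eq PiE_arb[OF x] PiE_arb[OF y] by fastforce
  with x i show ?upd by blast
next
  assume ?upd
  then show ?arc
    using assms by (auto intro: parcs_cartesian_product_updI)
qed

lemma map_tuple_parcs_cartesian_product:
  assumes "(k, k') \<in> parcs (cartesian_product I D)"
  shows "(map_tuple I f k, map_tuple I f k') \<in>
    parcs (cartesian_product I (\<lambda>i. map_digraph (f i) (D i)))"
proof -
  from assms obtain i where k: "k \<in> (\<Pi>\<^sub>E i\<in>I. pverts (D i))" "k' \<in> (\<Pi>\<^sub>E i\<in>I. pverts (D i))"
    and i: "i \<in> I" "(k i, k' i) \<in> parcs (D i)" and eq: "\<forall>l\<in>I - {i}. k l = k' l"
    by (auto simp: cartesian_product_def)
  have "map_tuple I f k \<in> (\<Pi>\<^sub>E i\<in>I. f i ` pverts (D i))"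
    "map_tuple I f k' \<in> (\<Pi>\<^sub>E i\<in>I. f i ` pverts (D i))"
    using k unfolding image_map_tuple_PiE[symmetric] by simp_all
  moreover have "(map_tuple I f k i, map_tuple I f k' i) \<in> parcs (map_digraph (f i) (D i))"
    "\<forall>l\<in>I - {i}. map_tuple I f k l = map_tuple I f k' l"
    using i eq by auto
  ultimately show ?thesis
    using i(1)
    by (simp add: cartesian_product_def del: map_tuple_apply parcs_map_digraph) blast
qed

lemma cartesian_product_map_digraph:
  assumes wf: "\<And>i. i \<in> I \<Longrightarrow> pair_wf_digraph (D i)"
  shows "cartesian_product I (\<lambda>i. map_digraph (f i) (D i)) =
    map_digraph (map_tuple I f) (cartesian_product I D)"
    (is "?L = ?R")
proof -
  have "parcs ?L = parcs ?R"
  proof (intro equalityI subrelI)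
    fix x y assume "(x, y) \<in> parcs ?L"
    then obtain i p q where x: "x \<in> map_tuple I f ` (\<Pi>\<^sub>E i\<in>I. pverts (D i))" and i: "i \<in> I"
      and pq: "(p, q) \<in> parcs (D i)" "x i = f i p" and y: "y = x(i := f i q)"
      by (auto simp: in_parcs_cartesian_product_iff wf pair_wf_digraph_map_digraph
          image_map_tuple_PiE)
    from x obtain k where k: "k \<in> (\<Pi>\<^sub>E i\<in>I. pverts (D i))" "x = map_tuple I f k"
      by blast
    let ?k = "k(i := p)"
    have "?k \<in> (\<Pi>\<^sub>E i\<in>I. pverts (D i))"
      using k(1) i pair_wf_digraph.in_arcsD1[OF wf[OF i] pq(1)] by (rule PiE_upd_in)
    then have "(?k, ?k(i := q)) \<in> parcs (cartesian_product I D)"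
      using i wf[OF i] pq(1) by (intro parcs_cartesian_product_updI) simp_all
    moreover have "x = map_tuple I f ?k" "y = map_tuple I f (?k(i := q))"
      using i k(2) pq(2) y by (simp_all only: map_tuple_upd fun_upd_upd fun_upd_idem)
    ultimately show "(x, y) \<in> parcs ?R"
      by auto
  next
    fix x y assume "(x, y) \<in> parcs ?R"
    then show "(x, y) \<in> parcs ?L"
      by (auto intro: map_tuple_parcs_cartesian_product)
  qed
  then show ?thesis
    by (simp add: image_map_tuple_PiE pair_pre_digraph.equality)
qed

lemma rtrancl_cartesian_product_upd:
  assumes wf: "\<And>i. i \<in> I \<Longrightarrow> pair_wf_digraph (D i)"
    and x: "x \<in> (\<Pi>\<^sub>E i\<in>I. pverts (D i))" and i: "i \<in> I"
    and "(x i, u) \<in> (parcs (D i))\<^sup>*"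
  shows "(x, x(i := u)) \<in> (parcs (cartesian_product I D))\<^sup>*"
  using assms(4)
proof (induction rule: rtrancl_induct)
  case base
  then show ?case by simp
next
  case (step u w)
  have "u \<in> pverts (D i)"
    using pair_wf_digraph.in_arcsD1[OF wf[OF i] step.hyps(2)] .
  then have "x(i := u) \<in> (\<Pi>\<^sub>E i\<in>I. pverts (D i))"
    using x i by (intro PiE_upd_in)
  then have "(x(i := u), x(i := u, i := w)) \<in> parcs (cartesian_product I D)"
    using i wf[OF i] step.hyps(2) by (intro parcs_cartesian_product_updI) simp_all
  then have "(x(i := u), x(i := w)) \<in> parcs (cartesian_product I D)"
    by simp
  with step.IH show ?case by (rule rtrancl_into_rtrancl)
qed

lemma rtrancl_cartesian_product:
  assumes wf: "\<And>i. i \<in> I \<Longrightarrow> pair_wf_digraph (D i)" and "finite I"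
    and x: "x \<in> (\<Pi>\<^sub>E i\<in>I. pverts (D i))" and y: "y \<in> (\<Pi>\<^sub>E i\<in>I. pverts (D i))"
    and path: "\<And>i. i \<in> I \<Longrightarrow> (x i, y i) \<in> (parcs (D i))\<^sup>*"
  shows "(x, y) \<in> (parcs (cartesian_product I D))\<^sup>*"
proof -
  have "(x, override_on x y J) \<in> (parcs (cartesian_product I D))\<^sup>*" if "finite J" "J \<subseteq> I" for J
    using that
  proof (induction J rule: finite_induct)
    case empty
    then show ?case by simp
  next
    case (insert i J)
    let ?z = "override_on x y J"
    have i: "i \<in> I" and z_i: "?z i = x i"
      using insert by auto
    have "?z \<in> (\<Pi>\<^sub>E i\<in>I. pverts (D i))"
      using x y by (auto simp: override_on_def PiE_iff extensional_def)
    then have "(?z, ?z(i := y i)) \<in> (parcs (cartesian_product I D))\<^sup>*"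
      using rtrancl_cartesian_product_upd[of I D, OF wf] i path[OF i] by (simp add: z_i)
    moreover have "(x, ?z) \<in> (parcs (cartesian_product I D))\<^sup>*"
      using insert by simp
    ultimately show ?case
      unfolding override_on_insert by (rule rtrancl_trans[rotated])
  qed
  moreover have "override_on x y I = y"
    using x y by (auto simp: override_on_def PiE_iff extensional_def)
  ultimately show ?thesis
    using \<open>finite I\<close> by (metis order_refl)
qed

subsection \<open>Oriented paths and grids\<close>

lemma pverts_oriented_path [simp]: "pverts (oriented_path a m) = a ` {1..m}"
  by (simp add: oriented_path_def)

lemma parcs_oriented_path:
  "parcs (oriented_path a m) = {(a j, a (Suc j)) | j. 1 \<le> j \<and> j < m}"
  by (simp add: oriented_path_def)

lemma pair_wf_digraph_oriented_path: "pair_wf_digraph (oriented_path a m)"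
  by unfold_locales (auto simp: parcs_oriented_path)

lemma oriented_path_eq_map_digraph: "oriented_path a m = map_digraph a (oriented_path id m)"
  by (rule pair_pre_digraph.equality) (auto simp: parcs_oriented_path image_iff)

lemma in_parcs_oriented_path_iff:
  assumes "inj_on a {1..m}" "1 \<le> j" "j \<le> m"
  shows "(a j, w) \<in> parcs (oriented_path a m) \<longleftrightarrow> j < m \<and> w = a (Suc j)"
  using inj_onD[OF assms(1), of j] assms(2,3) by (fastforce simp: parcs_oriented_path)

lemma rtrancl_oriented_path:
  assumes "j \<le> j'" "1 \<le> j" "j' \<le> m"
  shows "(a j, a j') \<in> (parcs (oriented_path a m))\<^sup>*"
  using assms
proof (induction rule: dec_induct)
  case base
  then show ?case by simp
next
  case (step l)
  then have "(a l, a (Suc l)) \<in> parcs (oriented_path a m)"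
    by (auto simp: parcs_oriented_path)
  with step show ?case
    by (meson Suc_leD rtrancl_into_rtrancl)
qed

definition grid :: "'i set \<Rightarrow> ('i \<Rightarrow> nat) \<Rightarrow> ('i \<Rightarrow> nat) pair_pre_digraph" where
  "grid I n = cartesian_product I (\<lambda>i. oriented_path id (n i))"

lemma pverts_grid [simp]: "pverts (grid I n) = (\<Pi>\<^sub>E i\<in>I. {1..n i})"
  by (simp add: grid_def)

lemma grid_bounds:
  assumes "k \<in> pverts (grid I n)" "i \<in> I"
  shows "1 \<le> k i" "k i \<le> n i"
  using assms by (auto simp: PiE_iff)

lemma pair_wf_digraph_grid: "pair_wf_digraph (grid I n)"
  unfolding grid_def by (rule pair_wf_digraph_cartesian_product)

lemma in_parcs_grid_iff:
  "(k, k') \<in> parcs (grid I n) \<longleftrightarrow>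
    k \<in> pverts (grid I n) \<and> (\<exists>i\<in>I. k i < n i \<and> k' = k(i := Suc (k i)))"
proof -
  have "(k i, u) \<in> parcs (oriented_path id (n i)) \<longleftrightarrow> k i < n i \<and> u = Suc (k i)"
    if "k \<in> pverts (grid I n)" "i \<in> I" for i u
    using in_parcs_oriented_path_iff[of id "n i" "k i" u] that by (auto simp: PiE_iff)
  then show ?thesis
    unfolding grid_def by (auto simp: in_parcs_cartesian_product_iff pair_wf_digraph_oriented_path)
qed

lemma rtrancl_grid:
  assumes "finite I" "k \<in> pverts (grid I n)"
  shows "(\<lambda>i\<in>I. 1, k) \<in> (parcs (grid I n))\<^sup>*"
  unfolding grid_def
proof (rule rtrancl_cartesian_product)
  fix i assume "i \<in> I"
  then show "((\<lambda>i\<in>I. 1) i, k i) \<in> (parcs (oriented_path id (n i)))\<^sup>*"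
    using rtrancl_oriented_path[of 1 "k i" "n i" id] assms(2) by (auto simp: PiE_iff)
qed (use assms in \<open>auto simp: pair_wf_digraph_oriented_path PiE_iff\<close>)

lemma path_product_eq_map_digraph:
  "path_product r n a = map_digraph (map_tuple {1..r} a) (grid {1..r} n)"
  unfolding path_product_def grid_def oriented_path_eq_map_digraph[of "a _"]
  by (rule cartesian_product_map_digraph) (rule pair_wf_digraph_oriented_path)

lemma digraph_iso_grid_path_product:
  assumes "\<And>i. i \<in> {1..r} \<Longrightarrow> inj_on (a i) {1..n i}"
  shows "digraph_iso (with_proj (grid {1..r} n)) (with_proj (path_product r n a))"
  unfolding path_product_eq_map_digraph
  by (intro digraph_iso_map_digraph pair_wf_digraph_grid)
    (use inj_on_map_tuple[of "{1..r}" a, OF assms] in simp)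

subsection \<open>Pebbling moves\<close>

text \<open>The effect of one move along each arc of \<open>F\<close>. A move along an arc \<open>(v, w)\<close> is only
  allowed if \<open>v\<close> has two pebbles, so in an order in which all these moves are possible nothing is
  truncated.\<close>

definition fire :: "('v \<times> 'v) set \<Rightarrow> ('v \<Rightarrow> nat) \<Rightarrow> 'v \<Rightarrow> nat" where
  "fire F A v = A v + card (F\<inverse> `` {v}) - 2 * card (F `` {v})"

lemma fire_empty [simp]: "fire {} A = A"
  by (simp add: fire_def fun_eq_iff)

lemma fire_singleton:
  "fire {(v, w)} A u = A u + of_bool (u = w) - 2 * of_bool (u = v)"
proof -
  have "{(v, w)}\<inverse> `` {u} = (if u = w then {v} else {})"
    "{(v, w)} `` {u} = (if u = v then {w} else {})"
    by auto
  then show ?thesis by (simp add: fire_def)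
qed

lemma fire_insert:
  assumes "finite F" "v \<notin> Domain F" "w \<notin> Domain F"
  shows "fire (insert (v, w) F) A = fire {(v, w)} (fire F A)"
proof
  fix u
  let ?F = "insert (v, w) F"
  have "?F\<inverse> `` {u} = (if u = w then insert v (F\<inverse> `` {u}) else F\<inverse> `` {u})"
    "?F `` {u} = (if u = v then insert w (F `` {u}) else F `` {u})"
    by auto
  moreover have "v \<notin> F\<inverse> `` {u}" "u = v \<Longrightarrow> F `` {u} = {}" "finite (F\<inverse> `` {u})"
    using assms by auto
  ultimately have cards: "card (?F\<inverse> `` {u}) = card (F\<inverse> `` {u}) + of_bool (u = w)"
    "card (?F `` {u}) = card (F `` {u}) + of_bool (u = v)"
    by (cases "u = w"; cases "u = v"; simp del: Image_singleton_iff)+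
  have "u = w \<Longrightarrow> F `` {u} = {}"
    using assms(3) by auto
  with cards show "fire ?F A u = fire {(v, w)} (fire F A) u"
    unfolding fire_singleton unfolding fire_def by (auto simp: card_eq_0_iff)
qed

lemma pebbling_move_iff_fire:
  "pebbling_move G A B \<longleftrightarrow> (\<exists>(v, w) \<in> parcs G. 2 \<le> A v \<and> B = fire {(v, w)} A)"
proof -
  have "A(v := A v - 2, w := (A(v := A v - 2)) w + 1) = fire {(v, w)} A" if "2 \<le> A v" for v w
    using that by (auto simp: fire_singleton fun_eq_iff)
  then have "2 \<le> A v \<and> B = A(v := A v - 2, w := (A(v := A v - 2)) w + 1) \<longleftrightarrow>
      2 \<le> A v \<and> B = fire {(v, w)} A" for v w
    by metis
  then show ?thesis
    unfolding pebbling_move_def Let_def by (simp only:)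
qed

lemma rtranclp_iff_image_pverts:
  assumes wf: "pair_wf_digraph D" and s: "s \<in> pverts D"
    and reach: "\<And>x. x \<in> pverts D \<Longrightarrow> (s, x) \<in> (parcs D)\<^sup>*"
    and step_iff: "\<And>x b. x \<in> pverts D \<Longrightarrow> R (f x) b \<longleftrightarrow> (\<exists>y. (x, y) \<in> parcs D \<and> b = f y)"
  shows "R\<^sup>*\<^sup>* (f s) b \<longleftrightarrow> b \<in> f ` pverts D"
proof
  assume "R\<^sup>*\<^sup>* (f s) b"
  then show "b \<in> f ` pverts D"
  proof (induction rule: rtranclp_induct)
    case base
    then show ?case
      using s by blast
  next
    case (step b c)
    then show ?case
      using step_iff pair_wf_digraph.in_arcsD2[OF wf] by auto
  qed
next
  have "R\<^sup>*\<^sup>* (f s) (f x)" if "(s, x) \<in> (parcs D)\<^sup>*" for x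
    using that
  proof (induction rule: rtrancl_induct)
    case base
    then show ?case by simp
  next
    case (step x y)
    then have "R (f x) (f y)"
      using step_iff pair_wf_digraph.in_arcsD1[OF wf] by blast
    with step.IH show ?case by simp
  qed
  then show "R\<^sup>*\<^sup>* (f s) b" if "b \<in> f ` pverts D"
    using that reach by blast
qed

lemma assignment_graph_eq_map_digraph:
  assumes wf: "pair_wf_digraph D" and s: "s \<in> pverts D"
    and reach: "\<And>x. x \<in> pverts D \<Longrightarrow> (s, x) \<in> (parcs D)\<^sup>*"
    and move_iff: "\<And>x B. x \<in> pverts D \<Longrightarrow>
      pebbling_move G (f x) B \<longleftrightarrow> (\<exists>y. (x, y) \<in> parcs D \<and> B = f y)"
  shows "assignment_graph G (f s) = map_digraph f D"
proof -
  have reachable_iff: "(pebbling_move G)\<^sup>*\<^sup>* (f s) A \<longleftrightarrow> A \<in> f ` pverts D" for A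
    using assms by (rule rtranclp_iff_image_pverts)
  have "A \<in> f ` pverts D \<and> B \<in> f ` pverts D \<and> pebbling_move G A B \<longleftrightarrow>
      (A, B) \<in> map_prod f f ` parcs D" for A B
  proof
    assume "A \<in> f ` pverts D \<and> B \<in> f ` pverts D \<and> pebbling_move G A B"
    then obtain x y where "(x, y) \<in> parcs D" "A = f x" "B = f y"
      using move_iff by auto
    then show "(A, B) \<in> map_prod f f ` parcs D"
      by auto
  next
    assume "(A, B) \<in> map_prod f f ` parcs D"
    then obtain x y where "(x, y) \<in> parcs D" "A = f x" "B = f y"
      by auto
    then show "A \<in> f ` pverts D \<and> B \<in> f ` pverts D \<and> pebbling_move G A B"
      using move_iff pair_wf_digraph.in_arcsD1[OF wf] pair_wf_digraph.in_arcsD2[OF wf] by auto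
  qed
  then show ?thesis
    by (auto simp: assignment_graph_def map_digraph_def reachable_iff)
qed

subsection \<open>Domino chains\<close>

locale domino_chains =
  fixes G :: "'v pair_pre_digraph"
    and I :: "'i set"
    and n :: "'i \<Rightarrow> nat"
    and c :: "'i \<Rightarrow> nat \<Rightarrow> 'v"
    and S :: "'v \<Rightarrow> nat"
  assumes finite_I: "finite I"
    and n_pos: "i \<in> I \<Longrightarrow> 1 \<le> n i"
    and chain_eqD: "\<lbrakk>i \<in> I; 1 \<le> j; j < n i; l \<in> I; 1 \<le> m; m \<le> n l; c i j = c l m\<rbrakk>
      \<Longrightarrow> i = l \<and> j = m"
    and arc_from_chain_iff: "\<lbrakk>i \<in> I; 1 \<le> j; j < n i\<rbrakk> \<Longrightarrow>
      (c i j, w) \<in> parcs G \<longleftrightarrow> w = c i (Suc j)"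
    and no_arc_from_chain_end: "i \<in> I \<Longrightarrow> (c i (n i), w) \<notin> parcs G"
    and pebbles_first: "\<lbrakk>i \<in> I; 1 < n i\<rbrakk> \<Longrightarrow> S (c i 1) \<in> {2, 3}"
    and pebbles_inner: "\<lbrakk>i \<in> I; 1 < j; j < n i\<rbrakk> \<Longrightarrow> S (c i j) = 1"
    and pebbles_off_chains: "\<lbrakk>(v, w) \<in> parcs G;
      \<And>i j. \<lbrakk>i \<in> I; 1 \<le> j; j < n i\<rbrakk> \<Longrightarrow> v \<noteq> c i j\<rbrakk> \<Longrightarrow> S v \<le> 1"
begin

definition crossed :: "('i \<Rightarrow> nat) \<Rightarrow> ('v \<times> 'v) set" where
  "crossed k = {(c i j, c i (Suc j)) | i j. i \<in> I \<and> 1 \<le> j \<and> j < k i}"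

definition config :: "('i \<Rightarrow> nat) \<Rightarrow> 'v \<Rightarrow> nat" where
  "config k = fire (crossed k) S"

lemma finite_crossed: "finite (crossed k)"
proof -
  have "crossed k = (\<lambda>(i, j). (c i j, c i (Suc j))) ` (SIGMA i:I. {1..<k i})"
    by (force simp: crossed_def)
  then show ?thesis
    using finite_I by simp
qed

lemma crossed_upd_Suc:
  assumes "i \<in> I" "1 \<le> k i"
  shows "crossed (k(i := Suc (k i))) = insert (c i (k i), c i (Suc (k i))) (crossed k)"
  using assms by (auto simp: crossed_def less_Suc_eq split: if_splits)

lemma chain_in_Domain_crossed_iff:
  assumes k: "k \<in> pverts (grid I n)" and i: "i \<in> I" "1 \<le> j" "j \<le> n i"
  shows "c i j \<in> Domain (crossed k) \<longleftrightarrow> j < k i"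
proof
  assume "c i j \<in> Domain (crossed k)"
  then obtain l m where l: "l \<in> I" "1 \<le> m" "m < k l" "c l m = c i j"
    by (auto simp: crossed_def)
  then have "l = i \<and> m = j"
    using i grid_bounds[OF k l(1)] by (intro chain_eqD) auto
  with l show "j < k i" by simp
qed (use i in \<open>auto simp: crossed_def\<close>)

lemma crossed_from_chain:
  assumes k: "k \<in> pverts (grid I n)" and i: "i \<in> I" "1 \<le> j" "j < n i"
  shows "crossed k `` {c i j} = (if j < k i then {c i (Suc j)} else {})"
proof -
  have "w = c i (Suc j)" if "(c i j, w) \<in> crossed k" for w
    using that chain_eqD[OF i] grid_bounds[OF k] by (fastforce simp: crossed_def)
  moreover have "(c i j, c i (Suc j)) \<in> crossed k" if "j < k i"
    using that i by (auto simp: crossed_def)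
  moreover have "c i j \<notin> Domain (crossed k)" if "\<not> j < k i"
    using that chain_in_Domain_crossed_iff[OF k i(1,2)] i(3) by simp
  ultimately show ?thesis
    by (auto simp: Domain_iff)
qed

lemma crossed_into_chain:
  assumes k: "k \<in> pverts (grid I n)" and i: "i \<in> I" "1 \<le> j" "j < n i"
  shows "(crossed k)\<inverse> `` {c i j} = (if 1 < j \<and> j \<le> k i then {c i (j - 1)} else {})"
proof -
  have "u = c i (j - 1) \<and> 1 < j \<and> j \<le> k i" if "(u, c i j) \<in> crossed k" for u
  proof -
    from that obtain l m where l: "l \<in> I" "1 \<le> m" "m < k l" "u = c l m" "c i j = c l (Suc m)"
      by (auto simp: crossed_def)
    then have "i = l \<and> j = Suc m"
      using i grid_bounds[OF k l(1)] by (intro chain_eqD) auto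
    with l show ?thesis by auto
  qed
  moreover have "(c i (j - 1), c i j) \<in> crossed k" if "1 < j" "j \<le> k i"
    using that i by (auto simp: crossed_def intro!: exI[of _ i] exI[of _ "j - 1"])
  ultimately show ?thesis
    by auto
qed

lemma config_chain_ge_2_iff:
  assumes k: "k \<in> pverts (grid I n)" and i: "i \<in> I" "1 \<le> j" "j < n i"
  shows "2 \<le> config k (c i j) \<longleftrightarrow> j = k i"
proof -
  have pebbles: "config k (c i j) = S (c i j) + of_bool (1 < j \<and> j \<le> k i) - 2 * of_bool (j < k i)"
    by (simp add: config_def fire_def crossed_from_chain[OF k i] crossed_into_chain[OF k i])
  show ?thesis
  proof (cases "j = 1")
    case True
    then show ?thesis
      using pebbles pebbles_first[of i] grid_bounds[OF k i(1)] i by auto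
  next
    case False
    then show ?thesis
      using pebbles pebbles_inner[of i j] i by auto
  qed
qed

lemma config_off_chains:
  assumes k: "k \<in> pverts (grid I n)"
    and off: "\<And>i j. \<lbrakk>i \<in> I; 1 \<le> j; j \<le> n i\<rbrakk> \<Longrightarrow> v \<noteq> c i j"
  shows "config k v = S v"
proof -
  have "v \<noteq> c l m \<and> v \<noteq> c l (Suc m)" if "l \<in> I" "1 \<le> m" "m < k l" for l m
    using that off[of l m] off[of l "Suc m"] grid_bounds[OF k that(1)] by simp
  then have "crossed k `` {v} = {}" "(crossed k)\<inverse> `` {v} = {}"
    unfolding crossed_def by blast+
  then show ?thesis
    by (simp add: config_def fire_def)
qed

lemma movable_arc_iff:
  assumes k: "k \<in> pverts (grid I n)"
  shows "(v, w) \<in> parcs G \<and> 2 \<le> config k v \<longleftrightarrow>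
    (\<exists>i\<in>I. k i < n i \<and> v = c i (k i) \<and> w = c i (Suc (k i)))"
    (is "?movable \<longleftrightarrow> ?frontier")
proof
  assume movable: ?movable
  have "\<exists>i\<in>I. \<exists>j. 1 \<le> j \<and> j < n i \<and> v = c i j"
  proof (rule ccontr)
    assume off: "\<not> ?thesis"
    moreover have "v \<noteq> c i (n i)" if "i \<in> I" for i
      using movable no_arc_from_chain_end that by blast
    ultimately have "config k v = S v"
      by (intro config_off_chains[OF k]) (metis le_neq_implies_less)
    moreover have "S v \<le> 1"
      using movable off by (blast intro: pebbles_off_chains)
    ultimately show False
      using movable by simp
  qed
  then obtain i j where i: "i \<in> I" "1 \<le> j" "j < n i" "v = c i j"
    by blast
  then have "j = k i" "w = c i (Suc j)"
    using movable config_chain_ge_2_iff[OF k] arc_from_chain_iff by blast+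
  with i show ?frontier by blast
next
  assume ?frontier
  then show ?movable
    using arc_from_chain_iff config_chain_ge_2_iff[OF k] grid_bounds[OF k] by blast
qed

lemma config_upd_Suc:
  assumes k: "k \<in> pverts (grid I n)" and i: "i \<in> I" "k i < n i"
  shows "config (k(i := Suc (k i))) = fire {(c i (k i), c i (Suc (k i)))} (config k)"
proof -
  have "c i (k i) \<notin> Domain (crossed k)" "c i (Suc (k i)) \<notin> Domain (crossed k)"
    using chain_in_Domain_crossed_iff[OF k i(1)] grid_bounds[OF k i(1)] i(2) by auto
  then show ?thesis
    unfolding config_def crossed_upd_Suc[of i k, OF i(1) grid_bounds(1)[OF k i(1)]]
    by (intro fire_insert finite_crossed)
qed

lemma pebbling_move_config_iff:
  assumes k: "k \<in> pverts (grid I n)"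
  shows "pebbling_move G (config k) B \<longleftrightarrow> (\<exists>k'. (k, k') \<in> parcs (grid I n) \<and> B = config k')"
proof -
  have "pebbling_move G (config k) B \<longleftrightarrow>
      (\<exists>v w. ((v, w) \<in> parcs G \<and> 2 \<le> config k v) \<and> B = fire {(v, w)} (config k))"
    unfolding pebbling_move_iff_fire by blast
  also have "\<dots> \<longleftrightarrow>
      (\<exists>i\<in>I. k i < n i \<and> B = fire {(c i (k i), c i (Suc (k i)))} (config k))"
    unfolding movable_arc_iff[OF k] by blast
  also have "\<dots> \<longleftrightarrow> (\<exists>i\<in>I. k i < n i \<and> B = config (k(i := Suc (k i))))"
    using config_upd_Suc[OF k] by metis
  also have "\<dots> \<longleftrightarrow> (\<exists>k'. (k, k') \<in> parcs (grid I n) \<and> B = config k')"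
    unfolding in_parcs_grid_iff using k by blast
  finally show ?thesis .
qed

lemma inj_on_config: "inj_on config (pverts (grid I n))"
proof (rule inj_onI)
  fix k k' assume k: "k \<in> pverts (grid I n)" and k': "k' \<in> pverts (grid I n)"
    and eq: "config k = config k'"
  have "k i = k' i" if i: "i \<in> I" for i
  proof -
    have "j = k i \<longleftrightarrow> j = k' i" if "1 \<le> j" "j < n i" for j
      using config_chain_ge_2_iff[OF k i that] config_chain_ge_2_iff[OF k' i that] eq by simp
    from this[of "k i"] this[of "k' i"] show ?thesis
      using grid_bounds[OF k i] grid_bounds[OF k' i] by linarith
  qed
  with k k' show "k = k'"
    unfolding pverts_grid by (rule PiE_ext)
qed

lemma config_origin: "config (\<lambda>i\<in>I. 1) = S"
proof -
  have "crossed (\<lambda>i\<in>I. 1) = {}"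
    by (auto simp: crossed_def)
  then show ?thesis
    by (simp add: config_def)
qed

lemma assignment_graph_eq_map_grid: "assignment_graph G S = map_digraph config (grid I n)"
proof -
  have "assignment_graph G (config (\<lambda>i\<in>I. 1)) = map_digraph config (grid I n)"
  proof (rule assignment_graph_eq_map_digraph)
    show "(\<lambda>i\<in>I. 1) \<in> pverts (grid I n)"
      using n_pos by simp
  qed (simp_all only: pair_wf_digraph_grid rtrancl_grid finite_I pebbling_move_config_iff)
  then show ?thesis
    by (simp only: config_origin)
qed

lemma digraph_iso_grid_assignment_graph:
  "digraph_iso (with_proj (grid I n)) (with_proj (assignment_graph G S))"
  unfolding assignment_graph_eq_map_grid
  by (intro digraph_iso_map_digraph pair_wf_digraph_grid inj_on_config)

end

subsection \<open>The axes of a product of paths\<close>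

lemma axis_vertex_last: "i \<in> {1..r} \<Longrightarrow> axis_vertex r n a i (n i) = top_vertex r n a"
  by (auto simp: axis_vertex_def top_vertex_def)

lemma axis_vertex_apply:
  "\<lbrakk>i \<in> {1..r}; l \<in> {1..r}\<rbrakk> \<Longrightarrow>
    axis_vertex r n a i j l = (if l = i then a i j else a l (n l))"
  by (simp add: axis_vertex_def top_vertex_def)

locale injective_path_product =
  fixes r :: nat
    and n :: "nat \<Rightarrow> nat"
    and a :: "nat \<Rightarrow> nat \<Rightarrow> 'a"
  assumes n_pos: "i \<in> {1..r} \<Longrightarrow> 1 \<le> n i"
    and inj_a: "i \<in> {1..r} \<Longrightarrow> inj_on (a i) {1..n i}"
begin

abbreviation "axis \<equiv> axis_vertex r n a"

lemma a_eq_iff: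
  assumes "i \<in> {1..r}" "1 \<le> j" "j \<le> n i" "1 \<le> m" "m \<le> n i"
  shows "a i j = a i m \<longleftrightarrow> j = m"
  using inj_on_eq_iff[OF inj_a, of i j m] assms by auto

lemma axis_eqD:
  assumes i: "i \<in> {1..r}" "1 \<le> j" "j < n i" and l: "l \<in> {1..r}" "1 \<le> m" "m \<le> n l"
    and eq: "axis i j = axis l m"
  shows "i = l \<and> j = m"
proof -
  have at_i: "a i j = (if i = l then a i m else a i (n i))"
    using fun_cong[OF eq, of i] i(1) l(1) by (auto simp: axis_vertex_apply)
  moreover have "a i j \<noteq> a i (n i)"
    using a_eq_iff[of i j "n i"] i by simp
  ultimately have "i = l"
    by metis
  then show ?thesis
    using at_i a_eq_iff[of i j m] i l by simp
qed

lemma arc_from_axis_iff: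
  assumes i: "i \<in> {1..r}" "1 \<le> j" "j \<le> n i"
  shows "(axis i j, w) \<in> parcs (path_product r n a) \<longleftrightarrow> j < n i \<and> w = axis i (Suc j)"
proof -
  have "axis i j \<in> (\<Pi>\<^sub>E l\<in>{1..r}. a l ` {1..n l})"
    using i n_pos by (auto simp: axis_vertex_def top_vertex_def PiE_iff extensional_def)
  then have "(axis i j, w) \<in> parcs (path_product r n a) \<longleftrightarrow>
      (\<exists>l\<in>{1..r}. \<exists>u. (axis i j l, u) \<in> parcs (oriented_path (a l) (n l)) \<and> w = (axis i j)(l := u))"
    unfolding path_product_def
    by (simp add: in_parcs_cartesian_product_iff pair_wf_digraph_oriented_path)
  also have "\<dots> \<longleftrightarrow>
      (\<exists>l\<in>{1..r}. \<exists>u. (l = i \<and> j < n i \<and> u = a i (Suc j)) \<and> w = (axis i j)(l := u))"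
    using i n_pos inj_a
    by (intro bex_cong ex_cong1 refl conj_cong)
      (auto simp: axis_vertex_apply in_parcs_oriented_path_iff)
  also have "\<dots> \<longleftrightarrow> j < n i \<and> w = axis i (Suc j)"
    using i(1) by (auto simp: axis_vertex_def)
  finally show ?thesis .
qed

lemma no_arc_from_top_vertex: "(top_vertex r n a, w) \<notin> parcs (path_product r n a)"
proof
  assume arc: "(top_vertex r n a, w) \<in> parcs (path_product r n a)"
  then obtain i where "i \<in> {1..r}"
    by (auto simp: path_product_def cartesian_product_def)
  then show False
    using arc arc_from_axis_iff[of i "n i" w] n_pos axis_vertex_last[of i r n a] by simp
qed

lemma domino_chains_axes:
  assumes simple: "simple_pebbling r n a S"
  shows "domino_chains (path_product r n a) {1..r} n axis S"
proof
  fix i assume i: "i \<in> {1..r}"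
  show "1 \<le> n i"
    using i by (rule n_pos)
  show "(axis i (n i), w) \<notin> parcs (path_product r n a)" for w
    unfolding axis_vertex_last[OF i] by (rule no_arc_from_top_vertex)
  show "S (axis i 1) \<in> {2, 3}"
    using simple i unfolding simple_pebbling_def by blast
next
  fix i j assume j: "i \<in> {1..r}" "1 \<le> j" "j < n i"
  then show "(axis i j, w) \<in> parcs (path_product r n a) \<longleftrightarrow> w = axis i (Suc j)" for w
    using arc_from_axis_iff[of i j w] by simp
  show "i = l \<and> j = m" if "l \<in> {1..r}" "1 \<le> m" "m \<le> n l" "axis i j = axis l m" for l m
    using j that by (rule axis_eqD)
next
  show "S (axis i j) = 1" if "i \<in> {1..r}" "1 < j" "j < n i" for i j
    using simple that unfolding simple_pebbling_def by blast
next
  fix v w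
  assume arc: "(v, w) \<in> parcs (path_product r n a)"
    and off: "\<And>i j. \<lbrakk>i \<in> {1..r}; 1 \<le> j; j < n i\<rbrakk> \<Longrightarrow> v \<noteq> axis i j"
  have "v \<in> pverts (path_product r n a)"
    using arc unfolding path_product_def
    by (rule pair_wf_digraph.in_arcsD1[OF pair_wf_digraph_cartesian_product])
  moreover have "v \<noteq> top_vertex r n a"
    using arc no_arc_from_top_vertex by blast
  ultimately have "S v \<in> {0, 1}"
    using simple off unfolding simple_pebbling_def by blast
  then show "S v \<le> 1" by auto
qed simp

end

theorem theorem7p1:
  fixes r :: nat
    and n :: "nat \<Rightarrow> nat"
    and a :: "nat \<Rightarrow> nat \<Rightarrow> 'a"
    and S :: "(nat \<Rightarrow> 'a) \<Rightarrow> nat"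
  assumes "\<And>i. i \<in> {1..r} \<Longrightarrow> 1 \<le> n i"
    and "\<And>i. i \<in> {1..r} \<Longrightarrow> inj_on (a i) {1..n i}"
    and "simple_pebbling r n a S"
  shows "digraph_iso (with_proj (path_product r n a))
    (with_proj (assignment_graph (path_product r n a) S))"
proof -
  interpret injective_path_product r n a
    by unfold_locales fact+
  have "wf_digraph (with_proj (grid {1..r} n))"
    by (simp add: wf_digraph_wp_iff pair_wf_digraph_grid)
  then have "digraph_iso (with_proj (path_product r n a)) (with_proj (grid {1..r} n))"
    using digraph_iso_grid_path_product[OF assms(2)] by (rule digraph_iso_swap)
  also have "digraph_iso \<dots> (with_proj (assignment_graph (path_product r n a) S))"
    using domino_chains_axes[OF assms(3)]
    by (rule domino_chains.digraph_iso_grid_assignment_graph)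
  finally show ?thesis .
qed

end
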